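(* The set $E$ (five-Sierpinski) is not the attractor of any contractive IFS consisting of similitudes. That is, there do not exist $n\ge 1$ and contractive similitudes $f_1,\dots,f_n:\mathbb{R}^2\to\mathbb{R}^2$ such that $E$ is the attractor of the IFS $\{\mathbb{R}^2;f_1,\dots,f_n\}$.
   Context: A similitude is a map $f:\mathbb{R}^2\to\mathbb{R}^2$ for which there exist $\theta\in[0,2\pi)$, $k\in(0,+\infty)$ and $x_0,y_0\in\mathbb{R}$ such that $f\binom{x}{y}=k\begin{pmatrix}\cos\theta&-\sin\theta\\ \sin\theta&\cos\theta\end{pmatrix}\binom{x}{y}+\binom{x_0}{y_0}$ or $f\binom{x}{y}=k\begin{pmatrix}\cos\theta&\sin\theta\\ \sin\theta&-\cos\theta\end{pmatrix}\binom{x}{y}+\binom{x_0}{y_0}$; $k$ is its scaling factor, and $f$ is contractive if $k<1$. A contractive IFS consisting of similitudes is a finite family $\{\mathbb{R}^2;f_1,\dots,f_n\}$ of contractive similitudes; its attractor is the unique nonempty compact set $A\subset\mathbb{R}^2$ with $A=f_1(A)\cup\cdots\cup f_n(A)$. The Sierpinski gasket $S\subset\mathbb{R}^2$ is the attractor of the IFS consisting of $p\mapsto\frac12p$, $p\mapsto\frac12p+(\frac14,\frac{\sqrt3}{4})$, $p\mapsto\frac12p+(\frac12,0)$. Five-Sierpinski is $E=\bigcup_{j=0}^{4}\bigl(S+(j,0)\bigr)$. *)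

theory Defs
  imports "HOL-Analysis.Analysis"
begin

definition plane_rotation :: "real \<Rightarrow> real^2^2" where
  "plane_rotation \<theta> = vector [vector [cos \<theta>, - sin \<theta>], vector [sin \<theta>, cos \<theta>]]"

definition plane_reflection :: "real \<Rightarrow> real^2^2" where
  "plane_reflection \<theta> = vector [vector [cos \<theta>, sin \<theta>], vector [sin \<theta>, - cos \<theta>]]"

definition similitude_with_factor :: "real \<Rightarrow> (real^2 \<Rightarrow> real^2) \<Rightarrow> bool" where
  "similitude_with_factor k f \<longleftrightarrow> 0 < k \<and>
     (\<exists>\<theta>\<in>{0..<2 * pi}. \<exists>x0 y0 :: real.
        (\<forall>p. f p = k *\<^sub>R (plane_rotation \<theta> *v p) + vector [x0, y0]) \<or>
        (\<forall>p. f p = k *\<^sub>R (plane_reflection \<theta> *v p) + vector [x0, y0]))"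

definition contractive_similitude :: "(real^2 \<Rightarrow> real^2) \<Rightarrow> bool" where
  "contractive_similitude f \<longleftrightarrow> (\<exists>k<1. similitude_with_factor k f)"

definition attractor :: "(real^2 \<Rightarrow> real^2) list \<Rightarrow> (real^2) set" where
  "attractor fs = (THE A. A \<noteq> {} \<and> compact A \<and> A = (\<Union>f\<in>set fs. f ` A))"

definition gasket_ifs :: "(real^2 \<Rightarrow> real^2) list" where
  "gasket_ifs =
     [\<lambda>p. (1/2) *\<^sub>R p,
      \<lambda>p. (1/2) *\<^sub>R p + vector [1/4, sqrt 3 / 4],
      \<lambda>p. (1/2) *\<^sub>R p + vector [1/2, 0]]"

definition sierpinski_gasket :: "(real^2) set" where
  "sierpinski_gasket = attractor gasket_ifs"

definition five_sierpinski :: "(real^2) set" where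
  "five_sierpinski = (\<Union>j\<in>{0..4::nat}. (\<lambda>p. p + vector [real j, 0]) ` sierpinski_gasket)"

text \<open>The definite description in \<^const>\<open>attractor\<close> is well defined for every nonempty
  list of contractive similitudes (\<open>attractor_unique_existence\<close>), in particular for
  \<^const>\<open>gasket_ifs\<close>; the proofs follow.\<close>

lemma matrix_norm:
  "norm (plane_rotation \<theta> *v p) = norm p" "norm (plane_reflection \<theta> *v p) = norm p"
proof -
  have s: "(cos \<theta>)\<^sup>2 = 1 - (sin \<theta>)\<^sup>2" by (simp add: cos_squared_eq)
  have a: "(cos \<theta> * x - sin \<theta> * y)\<^sup>2 + (sin \<theta> * x + cos \<theta> * y)\<^sup>2 = x\<^sup>2 + y\<^sup>2" for x y :: real
    using s by algebra
  have b: "(cos \<theta> * x + sin \<theta> * y)\<^sup>2 + (sin \<theta> * x - cos \<theta> * y)\<^sup>2 = x\<^sup>2 + y\<^sup>2" for x y :: real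
    using s by algebra
  show "norm (plane_rotation \<theta> *v p) = norm p"
    using a[of "p$1" "p$2"]
    by (simp add: norm_vec_def L2_set_def sum_2 plane_rotation_def matrix_vector_mult_def)
  show "norm (plane_reflection \<theta> *v p) = norm p"
    using b[of "p$1" "p$2"]
    by (simp add: norm_vec_def L2_set_def sum_2 plane_reflection_def matrix_vector_mult_def)
qed

lemma similitude_dist:
  assumes "similitude_with_factor k f"
  shows "dist (f x) (f y) = k * dist x y"
proof -
  have *: "dist (f x) (f y) = k * dist x y"
    if "k > 0" and f: "\<And>p. f p = k *\<^sub>R (M *v p) + c"
      and n: "\<And>p. norm (M *v p) = norm p" for M :: "real^2^2" and c
  proof -
    have "f x - f y = k *\<^sub>R (M *v (x - y))"
      by (simp add: f matrix_vector_mult_diff_distrib scaleR_diff_right)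
    then show ?thesis using \<open>k > 0\<close> by (simp add: dist_norm n)
  qed
  show ?thesis
    using assms * matrix_norm unfolding similitude_with_factor_def by blast
qed

lemma gasket_ifs_contractive: "\<forall>f\<in>set gasket_ifs. contractive_similitude f"
proof -
  have r: "plane_rotation 0 *v p = p" for p
    by (simp add: vec_eq_iff forall_2 plane_rotation_def matrix_vector_mult_def sum_2)
  have z: "vector [0, 0] = (0::real^2)" by (simp add: vec_eq_iff forall_2)
  have "contractive_similitude (\<lambda>p. (1/2) *\<^sub>R p + vector [a, b])" for a b
    unfolding contractive_similitude_def similitude_with_factor_def
    by (intro exI[of _ "1/2::real"] conjI bexI[of _ "0::real"] exI[of _ a] exI[of _ b] disjI1)
       (auto simp: r)
  from this this[of 0 0] show ?thesis unfolding gasket_ifs_def by (simp add: z)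
qed

lemma invariant_set_subset:
  fixes A B :: "(real^2) set"
  assumes contr: "\<And>f x y. f \<in> set fs \<Longrightarrow> dist (f x) (f y) \<le> k * dist x y" and "0 < k" "k < 1"
    and A: "A \<noteq> {}" "compact A" "A = (\<Union>f\<in>set fs. f ` A)"
    and B: "B \<noteq> {}" "compact B" "B = (\<Union>f\<in>set fs. f ` B)"
  shows "A \<subseteq> B"
proof -
  obtain a where a: "a \<in> A" and max: "\<And>x. x \<in> A \<Longrightarrow> infdist x B \<le> infdist a B"
    using continuous_attains_sup[OF A(2,1), of "\<lambda>x. infdist x B"] continuous_on_infdist[of A "\<lambda>x. x" B]
    by auto
  obtain f a' where f: "f \<in> set fs" "a' \<in> A" "a = f a'" using a A(3) by blast
  obtain b where b: "b \<in> B" "infdist a' B = dist a' b"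
    using infdist_attains_inf[OF compact_imp_closed[OF B(2)] B(1)] by metis
  have "f b \<in> B" using b f B(3) by blast
  then have "infdist a B \<le> dist a (f b)" by (rule infdist_le)
  also have "\<dots> \<le> k * infdist a' B" using contr[OF f(1)] f b by simp
  also have "\<dots> \<le> k * infdist a B" using max[OF f(2)] \<open>0 < k\<close> by simp
  finally have "(1 - k) * infdist a B \<le> 0" by (simp add: algebra_simps)
  then have z: "infdist a B \<le> 0" using \<open>k < 1\<close> by (simp add: mult_le_0_iff)
  show ?thesis
  proof
    fix x assume "x \<in> A"
    then have "infdist x B = 0" using max z infdist_nonneg[of x B] by fastforce
    then show "x \<in> B"
      using in_closed_iff_infdist_zero[OF compact_imp_closed[OF B(2)] B(1)] by simp
  qed
qed

lemma invariant_set_exists: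
  fixes fs :: "(real^2 \<Rightarrow> real^2) list"
  assumes contr: "\<And>f x y. f \<in> set fs \<Longrightarrow> dist (f x) (f y) \<le> k * dist x y" and "0 < k" "k < 1"
    and "fs \<noteq> []"
  shows "\<exists>A. A \<noteq> {} \<and> compact A \<and> A = (\<Union>f\<in>set fs. f ` A)"
proof -
  define H where "H A = (\<Union>f\<in>set fs. f ` A)" for A
  have mono: "A \<subseteq> B \<Longrightarrow> H A \<subseteq> H B" for A B unfolding H_def by blast
  have cont: "continuous_on S f" if "f \<in> set fs" for f S
    by (rule lipschitz_on_continuous_on[of k]) (use contr that \<open>0 < k\<close> in \<open>auto simp: lipschitz_on_def\<close>)
  define r where "r = Max ((\<lambda>f. norm (f 0)) ` set fs) / (1 - k)"
  have fr: "norm (f 0) \<le> (1 - k) * r" if "f \<in> set fs" for f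
    using that \<open>k < 1\<close> by (auto simp: r_def intro!: Max_ge)
  have "r \<ge> 0"
  proof -
    obtain f where "f \<in> set fs" using \<open>fs \<noteq> []\<close> by fastforce
    then have "0 \<le> (1 - k) * r" using fr[of f] norm_ge_zero order_trans by blast
    then show ?thesis using \<open>k < 1\<close> by (simp add: zero_le_mult_iff)
  qed
  define C where "C n = (H ^^ n) (cball 0 r)" for n
  have Suc: "C (Suc n) = H (C n)" for n by (simp add: C_def)
  have "H (cball 0 r) \<subseteq> cball 0 r"
  proof -
    have "norm (f x) \<le> r" if "f \<in> set fs" "norm x \<le> r" for f x
    proof -
      have "norm (f x) \<le> norm (f 0) + dist (f x) (f 0)"
        unfolding dist_norm by norm
      also have "\<dots> \<le> (1 - k) * r + k * norm x"
        using fr contr[of f x 0] that by (intro add_mono) auto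
      also have "\<dots> \<le> (1 - k) * r + k * r" using that \<open>0 < k\<close> by simp
      finally show ?thesis by (simp add: algebra_simps)
    qed
    then show ?thesis unfolding H_def by auto
  qed
  then have dec1: "C (Suc n) \<subseteq> C n" for n
    by (induction n) (simp_all add: Suc mono, simp add: C_def)
  then have dec: "m \<le> n \<Longrightarrow> C n \<subseteq> C m" for m n by (rule lift_Suc_antimono_le)
  have comp: "compact (C n)" for n
    by (induction n)
       (use cont in \<open>auto simp: Suc H_def C_def[of 0] intro!: compact_UN compact_continuous_image\<close>)
  have ne: "C n \<noteq> {}" for n
    by (induction n) (use \<open>fs \<noteq> []\<close> \<open>r \<ge> 0\<close> in \<open>auto simp: Suc H_def C_def[of 0]\<close>)
  define A where "A = (\<Inter>n. C n)"
  have "A \<noteq> {}" unfolding A_def by (rule compact_nest[OF comp ne dec])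
  moreover have "compact A"
  proof -
    have "closed A" unfolding A_def using comp compact_imp_closed by (intro closed_INT) auto
    moreover have "A = C 0 \<inter> A" unfolding A_def by auto
    ultimately show ?thesis using compact_Int_closed[OF comp[of 0], of A] by simp
  qed
  moreover have "H A \<subseteq> A"
  proof -
    have "H A \<subseteq> C n" for n
      using mono[of A "C n"] dec1[of n] unfolding Suc A_def by blast
    then show ?thesis unfolding A_def by blast
  qed
  moreover have "A \<subseteq> H A"
  proof
    fix x assume x: "x \<in> A"
    define D where "D n = C n \<inter> (\<Union>f\<in>set fs. f -` {x})" for n
    have "closed (f -` {x})" if "f \<in> set fs" for f
      by (rule closed_vimage[OF closed_singleton cont[OF that]])
    then have "closed (\<Union>f\<in>set fs. f -` {x})" by (intro closed_UN) auto
    then have "compact (D n)" for n unfolding D_def using comp by (simp add: compact_Int_closed)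
    moreover have "D n \<noteq> {}" for n
    proof -
      have "x \<in> H (C n)" using x Suc unfolding A_def by blast
      then show ?thesis unfolding H_def D_def by blast
    qed
    moreover have "m \<le> n \<Longrightarrow> D n \<subseteq> D m" for m n unfolding D_def using dec by blast
    ultimately have "(\<Inter>n. D n) \<noteq> {}" by (rule compact_nest)
    then show "x \<in> H A" unfolding D_def H_def A_def by blast
  qed
  ultimately show ?thesis unfolding H_def by blast
qed

lemma attractor_unique_existence:
  assumes "fs \<noteq> []" "\<forall>f\<in>set fs. contractive_similitude f"
  shows "\<exists>!A. A \<noteq> {} \<and> compact A \<and> A = (\<Union>f\<in>set fs. f ` A)"
proof -
  obtain K where K: "\<And>f. f \<in> set fs \<Longrightarrow> K f < 1 \<and> similitude_with_factor (K f) f"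
    using assms(2) unfolding contractive_similitude_def by metis
  define k where "k = Max (K ` set fs)"
  have "k \<in> K ` set fs" unfolding k_def using assms(1) by (intro Max_in) auto
  then have k: "0 < k" "k < 1" using K unfolding similitude_with_factor_def by auto
  have contr: "dist (f x) (f y) \<le> k * dist x y" if "f \<in> set fs" for f x y
  proof -
    have "K f \<le> k" unfolding k_def using that by simp
    then show ?thesis
      using similitude_dist[of "K f" f x y] K[OF that] by (simp add: mult_right_mono)
  qed
  show ?thesis
  proof (rule ex_ex1I)
    show "\<exists>A. A \<noteq> {} \<and> compact A \<and> A = (\<Union>f\<in>set fs. f ` A)"
      using contr k assms(1) by (rule invariant_set_exists)
  next
    fix A B
    assume "A \<noteq> {} \<and> compact A \<and> A = (\<Union>f\<in>set fs. f ` A)"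
      and "B \<noteq> {} \<and> compact B \<and> B = (\<Union>f\<in>set fs. f ` B)"
    then show "A = B"
      using invariant_set_subset[of fs k A B, OF contr k] invariant_set_subset[of fs k B A, OF contr k]
      by blast
  qed
qed

lemma attractor_eq_iff:
  assumes "fs \<noteq> []" "\<forall>f\<in>set fs. contractive_similitude f"
  shows "A = attractor fs \<longleftrightarrow> A \<noteq> {} \<and> compact A \<and> A = (\<Union>f\<in>set fs. f ` A)"
proof
  assume "A = attractor fs"
  then show "A \<noteq> {} \<and> compact A \<and> A = (\<Union>f\<in>set fs. f ` A)"
    using theI'[OF attractor_unique_existence[OF assms]] unfolding attractor_def by simp
next
  assume "A \<noteq> {} \<and> compact A \<and> A = (\<Union>f\<in>set fs. f ` A)"
  then show "A = attractor fs"
    unfolding attractor_def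
    by (rule the1_equality[OF attractor_unique_existence[OF assms], symmetric])
qed

end

theory Submission
  imports Defs
begin

text \<open>
  If five-Sierpinski were an attractor, it would be covered by finitely many proper similar copies of
  itself lying inside it.  A single point of it that lies in no such copy therefore settles the
  matter, and the proof exhibits one.

  A copy of five-Sierpinski contains the outlines of five equal triangles standing in a row on a
  common base segment, and lies inside these five triangles.  Only such rows are used.  In
  barycentric coordinates the gasket is a subset of the unit simplex of \<open>\<real>\<^sup>3\<close>, its three
  halves are the corners \<open>p$i \<ge> 1/2\<close>, and doubling a corner reproduces the gasket.  Two corners meet in
  one point only, and that point lies on a side of the simplex, so a segment inside the gasket either
  stays in one corner or runs along a side (\<open>segment_in_corner_or_on_side\<close>).  Doubling again and
  again shows that every segment is parallel to a side (\<open>segment_constant_coordinate\<close>) and that a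
  long segment standing on a side starts at a dyadic point (\<open>dyadic_start\<close>).  Consequently a row inside
  the gasket either lies wholly in one corner, or stands on a side and consists of triangles
  of size \<open>1/2^n\<close> (\<open>row_dichotomy\<close>).

  Consider the point with barycentric coordinates \<open>4/7\<close>, \<open>2/7\<close>, \<open>1/7\<close>, whose address in the gasket runs
  periodically through the three corners.  Five triangles in a row have size at most \<open>1/5\<close>, hence at
  most \<open>1/8\<close> when they stand on a side, and thus stay below the height \<open>1/7\<close> of the point over the
  nearest side.  So a row containing the point lies in one corner; doubling that corner
  permutes the coordinates of the point and doubles the row.  This can be repeated
  forever although rows have bounded size, so no row in the gasket contains the
  point (\<open>spiral_point_not_in_row_hull\<close>).

  Finally, five-Sierpinski shrunk by the factor \<open>1/8\<close> is made of five of the eight smallest triangles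
  at the bottom of the third subdivision of the gasket.  Proper copies become rows of triangles
  smaller than \<open>1/8\<close>, and the point placed in the middle one of the five gaskets avoids all of
  them: it lies at height \<open>1/14\<close>, whereas rows on the bottom side reach at most \<open>1/16\<close>, and
  zooming into the left corner once turns it into a point of the kind
  above (\<open>small_row_misses_point\<close>).
\<close>

section \<open>Segments in the gasket\<close>

definition shrink :: "3 \<Rightarrow> real^3 \<Rightarrow> real^3" where
  "shrink i p = (1/2) *\<^sub>R (p + axis i 1)"

definition zoom :: "3 \<Rightarrow> real^3 \<Rightarrow> real^3" where
  "zoom i p = 2 *\<^sub>R p - axis i 1"

lemma zoom_nth: "zoom i p $ n = 2 * p $ n - (if n = i then 1 else 0)"
  by (simp add: zoom_def axis_def)

lemma shrink_nth: "shrink i p $ n = (p $ n + (if n = i then 1 else 0)) / 2"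
  by (simp add: shrink_def axis_def)

lemma three_indices:
  fixes i j k n :: 3
  assumes "distinct [i, j, k]"
  shows "n = i \<or> n = j \<or> n = k"
  using assms exhaust_3[of i] exhaust_3[of j] exhaust_3[of k] exhaust_3[of n] by auto

lemma remaining_index:
  fixes i j :: 3
  assumes "i \<noteq> j"
  obtains k where "distinct [i, j, k]"
proof -
  have "distinct [i, j, 1] \<or> distinct [i, j, 2] \<or> distinct [i, j, 3]"
    using assms exhaust_3[of i] exhaust_3[of j] by auto
  then show thesis using that by blast
qed

lemma sum_three_indices:
  fixes i j k :: 3 and p :: "real^3"
  assumes "distinct [i, j, k]"
  shows "p$i + p$j + p$k = p$1 + p$2 + p$3"
  using assms exhaust_3[of i] exhaust_3[of j] exhaust_3[of k] by auto

text \<open>These are the properties of the gasket, in barycentric coordinates, on which the obstruction rests.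
  The last one includes points that belong to two corners: such a point can be zoomed into from
  either of them.\<close>
locale zoomable =
  fixes S :: "(real^3) set"
  assumes nonneg: "p \<in> S \<Longrightarrow> 0 \<le> p$i"
    and total: "p \<in> S \<Longrightarrow> p$1 + p$2 + p$3 = 1"
    and corner: "p \<in> S \<Longrightarrow> \<exists>i. 1/2 \<le> p$i"
    and zoom_in: "p \<in> S \<Longrightarrow> 1/2 \<le> p$i \<Longrightarrow> zoom i p \<in> S"
begin

lemma total_distinct:
  assumes "p \<in> S" and "distinct [i, j, k]"
  shows "p$i + p$j + p$k = 1"
  using sum_three_indices[OF assms(2), of p] total[OF assms(1)] by simp

lemma le_1:
  assumes "p \<in> S"
  shows "p$i \<le> 1"
  using total[OF assms] nonneg[OF assms, of 1] nonneg[OF assms, of 2] nonneg[OF assms, of 3]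
    exhaust_3[of i] by auto

text \<open>By connectedness, a segment that leaves a corner passes through a point of two corners.  Such a
  point has coordinates \<open>1/2\<close>, \<open>1/2\<close>, \<open>0\<close>, and a coordinate that is nonnegative on the segment and
  vanishes at an interior point vanishes on all of it.\<close>
lemma segment_in_corner_or_on_side:
  assumes seg: "closed_segment x y \<subseteq> S"
  shows "(\<exists>i. 1/2 \<le> x$i \<and> 1/2 \<le> y$i) \<or> (\<exists>i. x$i = 0 \<and> y$i = 0)"
proof (rule ccontr)
  assume "\<not> ?thesis"
  then have nc: "\<And>i. 1/2 \<le> x$i \<Longrightarrow> y$i < 1/2" and ns: "\<And>i. \<not> (x$i = 0 \<and> y$i = 0)"
    using not_le by blast+
  have xS: "x \<in> S" and yS: "y \<in> S" using seg by auto
  obtain i where xi: "1/2 \<le> x$i" using corner[OF xS] by blast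
  have yi: "y$i < 1/2" using nc[OF xi] .
  obtain j where ij: "j \<noteq> i" and yj: "1/2 \<le> y$j" using corner[OF yS] yi by force
  obtain k where d: "distinct [i, j, k]" using remaining_index[of i j] ij by metis
  define A where "A = {p::real^3. 1/2 \<le> p$i}"
  define B where "B = {p::real^3. 1/2 \<le> p$j} \<union> {p. 1/2 \<le> p$k}"
  have "closed A" "closed B"
    unfolding A_def B_def
    by (intro closed_Un closed_halfspace_component_ge_cart)+
  moreover have "closed_segment x y \<subseteq> A \<union> B"
  proof
    fix p assume "p \<in> closed_segment x y"
    then obtain l where "1/2 \<le> p$l" using seg corner by blast
    then show "p \<in> A \<union> B" unfolding A_def B_def using three_indices[OF d, of l] by auto
  qed
  moreover have "A \<inter> closed_segment x y \<noteq> {}" "B \<inter> closed_segment x y \<noteq> {}"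
    unfolding A_def B_def using xi yj by auto
  ultimately have "A \<inter> B \<inter> closed_segment x y \<noteq> {}"
    using connected_closedD[OF connected_segment(1)[of x y]] by metis
  then obtain z m where z: "z \<in> closed_segment x y" "1/2 \<le> z$i" and m: "m = j \<or> m = k" "1/2 \<le> z$m"
    unfolding A_def B_def by blast
  have "i \<noteq> m" using m d by auto
  then obtain n where dn: "distinct [i, m, n]" using remaining_index by metis
  have zS: "z \<in> S" using z seg by blast
  have zn: "z$i = 1/2" "z$m = 1/2" "z$n = 0"
    using total_distinct[OF zS dn] nonneg[OF zS, of n] z m by auto
  obtain t where t: "0 \<le> t" "t \<le> 1" "z = (1 - t) *\<^sub>R x + t *\<^sub>R y"
    using z(1) unfolding in_segment by blast
  show False
  proof (cases "t = 0")
    case True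
    then have xz: "x = z" using t by simp
    \<comment> \<open>The segment starts at the contact point; just after its start all three coordinates are
      below \<open>1/2\<close>, so it leaves the set at once.\<close>
    have ym: "y$m < 1/2" using nc[of m] zn xz by simp
    define p where "p = (1 - 1/4) *\<^sub>R x + (1/4) *\<^sub>R y"
    have "p \<in> closed_segment x y" unfolding p_def in_segment by (intro exI[of _ "1/4"]) simp
    then have "p \<in> S" using seg by blast
    then obtain l where "1/2 \<le> p$l" using corner by blast
    then have "1/2 \<le> (3/4) * x$l + (1/4) * y$l" by (simp add: p_def)
    moreover have "l = i \<or> l = m \<or> l = n" using three_indices[OF dn] .
    ultimately show False using zn xz ym yi le_1[OF yS, of n] by auto
  next
    case False
    have "t \<noteq> 1" using t(3) zn yi by auto
    then have t01: "0 < t" "t < 1" using False t by auto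
    have "(1 - t) * x$n + t * y$n = 0" using zn(3) t(3) by simp
    moreover have "0 \<le> (1 - t) * x$n" "0 \<le> t * y$n"
      using nonneg[OF xS, of n] nonneg[OF yS, of n] t01 by auto
    ultimately have "(1 - t) * x$n = 0" "t * y$n = 0" by linarith+
    moreover have "1 - t \<noteq> 0" "t \<noteq> 0" using t01 by linarith+
    ultimately have "x$n = 0 \<and> y$n = 0" unfolding mult_eq_0_iff by argo
    then show False by (rule notE[OF ns])
  qed
qed

lemma zoom_segment:
  assumes seg: "closed_segment x y \<subseteq> S" and xi: "1/2 \<le> x$i" and yi: "1/2 \<le> y$i"
  shows "closed_segment (zoom i x) (zoom i y) \<subseteq> S"
proof
  fix p assume "p \<in> closed_segment (zoom i x) (zoom i y)"
  then obtain t where t: "0 \<le> t" "t \<le> 1" "p = (1 - t) *\<^sub>R zoom i x + t *\<^sub>R zoom i y"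
    unfolding in_segment by blast
  define r where "r = (1 - t) *\<^sub>R x + t *\<^sub>R y"
  have "r \<in> closed_segment x y" unfolding r_def in_segment using t by blast
  then have "r \<in> S" using seg by blast
  moreover have "1/2 \<le> r$i"
  proof -
    have "(1 - t) * (1/2) \<le> (1 - t) * x$i" "t * (1/2) \<le> t * y$i"
      using t xi yi by (intro mult_left_mono; simp)+
    then have "(1 - t) * (1/2) + t * (1/2) \<le> r$i"
      unfolding r_def vector_add_component vector_scaleR_component real_scaleR_def
      by (rule add_mono)
    then show ?thesis by argo
  qed
  moreover have "p = zoom i r"
    unfolding t r_def zoom_def by (simp add: algebra_simps)
  ultimately show "p \<in> S" using zoom_in by simp
qed

text \<open>A segment along no side direction cannot lie on a side, so it can be zoomed into and doubled
  forever, which the boundedness of the set forbids.\<close>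
lemma segment_constant_coordinate:
  assumes "closed_segment x y \<subseteq> S"
  shows "\<exists>i. x$i = y$i"
proof (rule ccontr)
  assume neq: "\<not> ?thesis"
  have bound: "2^n * \<bar>x$1 - y$1\<bar> \<le> 1"
    if "closed_segment x y \<subseteq> S" "\<nexists>i. x$i = y$i" for n x y
    using that
  proof (induction n arbitrary: x y)
    case 0
    then have "x \<in> S" "y \<in> S" by auto
    then show ?case using le_1[of x 1] le_1[of y 1] nonneg[of x 1] nonneg[of y 1] by auto
  next
    case (Suc n)
    obtain i where i: "1/2 \<le> x$i" "1/2 \<le> y$i"
      using segment_in_corner_or_on_side[OF Suc.prems(1)] Suc.prems(2) by metis
    have "2^n * \<bar>zoom i x$1 - zoom i y$1\<bar> \<le> 1"
      using Suc.IH[OF zoom_segment[OF Suc.prems(1) i]] Suc.prems(2) by (simp add: zoom_nth)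
    moreover have "\<bar>zoom i x$1 - zoom i y$1\<bar> = 2 * \<bar>x$1 - y$1\<bar>"
      unfolding zoom_nth by (simp add: abs_if)
    ultimately show ?case by simp
  qed
  have pos: "0 < \<bar>x$1 - y$1\<bar>" using neq by simp
  obtain n :: nat where "1 / \<bar>x$1 - y$1\<bar> < 2^n" using real_arch_pow[of 2] by auto
  then have "1 < 2^n * \<bar>x$1 - y$1\<bar>" using pos by (simp add: field_simps)
  then show False using bound[OF assms neq, of n] by simp
qed

text \<open>Here a segment starts on the side \<open>jk\<close> and runs parallel to the side \<open>ik\<close>.  If its length exceeds
  \<open>1/2\<close>, it fits in no corner and must be that side, so it starts at the vertex \<open>k\<close>.  A shorter
  one is doubled until this applies.\<close>
lemma dyadic_start:
  assumes "closed_segment x y \<subseteq> S" and d: "distinct [i, j, k]"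
    and "x$i = 0" "x$j = y$j" and "1/2^(Suc n) < y$i"
  shows "2^n * x$j \<in> \<int>"
  using assms(1,3-)
proof (induction n arbitrary: x y)
  case (0 x y)
  have xS: "x \<in> S" and yS: "y \<in> S" using 0 by auto
  note tot = total_distinct[OF xS d] total_distinct[OF yS d]
  note nn = nonneg[OF xS, of j] nonneg[OF xS, of k] nonneg[OF yS, of j] nonneg[OF yS, of k]
  have "x$j = 0"
    using segment_in_corner_or_on_side[OF 0(1)]
  proof (elim disjE exE conjE)
    fix m assume "1/2 \<le> x$m" "1/2 \<le> y$m"
    then show ?thesis using three_indices[OF d, of m] 0 tot nn by auto
  next
    fix m assume "x$m = 0" "y$m = 0"
    then show ?thesis using three_indices[OF d, of m] 0 tot nn by auto
  qed
  then show ?case by simp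
next
  case (Suc n x y)
  have xS: "x \<in> S" and yS: "y \<in> S" using Suc.prems by auto
  note tot = total_distinct[OF xS d] total_distinct[OF yS d]
  note nn = nonneg[OF xS, of j] nonneg[OF xS, of k] nonneg[OF yS, of j] nonneg[OF yS, of k]
  have yi: "0 < y$i" using Suc.prems(4) by (smt (verit) zero_less_divide_1_iff zero_less_power)
  have yi2: "1/2^(Suc n) < 2 * y$i" using Suc.prems(4) by (simp add: field_simps)
  show ?case
    using segment_in_corner_or_on_side[OF Suc.prems(1)]
  proof (elim disjE exE conjE)
    fix m assume m: "1/2 \<le> x$m" "1/2 \<le> y$m"
    have mi: "m \<noteq> i" using m Suc.prems by auto
    have "2^n * zoom m x$j \<in> \<int>"
      using zoom_segment[OF Suc.prems(1) m] Suc.prems yi2 mi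
      by (intro Suc.IH[of _ "zoom m y"]) (auto simp: zoom_nth)
    then have "2^n * zoom m x$j + (if j = m then 2^n else 0) \<in> \<int>" by auto
    then show ?thesis by (simp add: zoom_nth algebra_simps split: if_splits)
  next
    fix m assume "x$m = 0" "y$m = 0"
    then have "x$j = 0" using three_indices[OF d, of m] Suc.prems tot nn yi by auto
    then show ?thesis by simp
  qed
qed

end

section \<open>Rows of five triangles\<close>

lemma norm_side_direction:
  fixes v :: "real^3"
  assumes "distinct [a, b, c]" "v$a = 0" "v$b = s" "v$c = - s"
  shows "(norm v)\<^sup>2 = 2 * s\<^sup>2"
proof -
  have "(norm v)\<^sup>2 = (v$1)\<^sup>2 + (v$2)\<^sup>2 + (v$3)\<^sup>2"
    by (simp add: norm_vec_def L2_set_def sum_3)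
  also have "\<dots> = (v$a)\<^sup>2 + (v$b)\<^sup>2 + (v$c)\<^sup>2"
    using sum_three_indices[OF assms(1), of "\<chi> n. (v$n)\<^sup>2"] by simp
  finally show ?thesis using assms by simp
qed

text \<open>The edge vectors of an equilateral triangle are pairwise not parallel.  If each is parallel to a
  side of the simplex, they use up the three side directions, and the common size \<open>s\<close> comes from the
  coordinate sums.  A negative \<open>s\<close> describes a triangle turned upside down.\<close>
lemma equilateral_directions:
  fixes v w :: "real^3"
  assumes sums: "v$1 + v$2 + v$3 = 0" "w$1 + w$2 + w$3 = 0"
    and dirs: "\<exists>i. v$i = 0" "\<exists>i. w$i = 0" "\<exists>i. v$i = w$i"
    and norms: "norm w = norm v" "norm (v - w) = norm v" "v \<noteq> 0"
  obtains a b c s where "distinct [a, b, c]" "s \<noteq> 0" "v$a = 0" "v$b = s" "v$c = - s"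
    "w$a = s" "w$b = 0" "w$c = - s"
proof -
  have not_parallel: False if "v$a = 0" "w$a = 0" for a
  proof -
    have "a \<noteq> a + 1" by simp
    then obtain b where ab: "a \<noteq> b" by blast
    then obtain c where d: "distinct [a, b, c]" using remaining_index by metis
    have vc: "v$c = - (v$b)" and wc: "w$c = - (w$b)"
      using sum_three_indices[OF d, of v] sum_three_indices[OF d, of w] sums that by auto
    have sq: "(norm u)\<^sup>2 = 2 * (u$b)\<^sup>2" if "u$a = 0" "u$c = - (u$b)" for u :: "real^3"
      using norm_side_direction[OF d] that by simp
    have 1: "(w$b)\<^sup>2 = (v$b)\<^sup>2" using sq[of v] sq[of w] norms(1) that vc wc by simp
    have 2: "(v$b - w$b)\<^sup>2 = (v$b)\<^sup>2" using sq[of v] sq[of "v - w"] norms(2) that vc wc by simp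
    have "v$b = 0"
    proof -
      have "w$b = v$b \<or> w$b = - (v$b)" using 1 by (simp add: power2_eq_iff)
      then show ?thesis
      proof
        assume "w$b = v$b" then show ?thesis using 2 by simp
      next
        assume "w$b = - (v$b)" then have "(2 * v$b)\<^sup>2 = (v$b)\<^sup>2" using 2 by simp
        then show ?thesis by (simp add: power_mult_distrib)
      qed
    qed
    then have "norm v = 0" using sq[of v] that vc by simp
    then show False using norms by simp
  qed
  obtain a b c where abc: "v$a = 0" "w$b = 0" "v$c = w$c" using dirs by blast
  then have d: "distinct [a, b, c]" using not_parallel by force
  have v0: "v$b \<noteq> 0" using not_parallel[of b] abc by blast
  have vc: "v$c = - (v$b)" using sum_three_indices[OF d, of v] sums abc by simp
  have "w$a = v$b" using sum_three_indices[OF d, of w] sums abc vc by simp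
  then show thesis using that[OF d v0] abc vc by simp
qed

text \<open>The triangles have the base points \<open>x + m v\<close>, \<open>x + (m + 1) v\<close> and the apexes \<open>x + m v + w\<close>.
  The frame collects their edges, the hull the full triangles.\<close>
definition row_frame :: "real^3 \<Rightarrow> real^3 \<Rightarrow> real^3 \<Rightarrow> (real^3) set" where
  "row_frame x v w = closed_segment x (x + 5 *\<^sub>R v) \<union>
     (\<Union>m<5::nat. closed_segment (x + real m *\<^sub>R v) (x + real m *\<^sub>R v + w) \<union>
            closed_segment (x + real (Suc m) *\<^sub>R v) (x + real m *\<^sub>R v + w))"

definition row_hull :: "real^3 \<Rightarrow> real^3 \<Rightarrow> real^3 \<Rightarrow> (real^3) set" where
  "row_hull x v w = {x + (real m + \<alpha>) *\<^sub>R v + \<beta> *\<^sub>R w | m \<alpha> \<beta>.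
     m < (5::nat) \<and> 0 \<le> \<alpha> \<and> 0 \<le> \<beta> \<and> \<alpha> + \<beta> \<le> 1}"

context zoomable
begin

definition row :: "real^3 \<Rightarrow> real^3 \<Rightarrow> real^3 \<Rightarrow> bool" where
  "row x v w \<longleftrightarrow> v \<noteq> 0 \<and> norm w = norm v \<and> norm (v - w) = norm v \<and> row_frame x v w \<subseteq> S"

lemma row_segments:
  assumes "row x v w"
  shows "closed_segment x (x + 5 *\<^sub>R v) \<subseteq> S"
    and "m < 5 \<Longrightarrow> closed_segment (x + real m *\<^sub>R v) (x + real m *\<^sub>R v + w) \<subseteq> S"
    and "m < 5 \<Longrightarrow> closed_segment (x + real (Suc m) *\<^sub>R v) (x + real m *\<^sub>R v + w) \<subseteq> S"
  using assms unfolding row_def row_frame_def by blast+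

lemma row_directions:
  assumes "row x v w"
  obtains a b c s where "distinct [a, b, c]" "s \<noteq> 0" "v$a = 0" "v$b = s" "v$c = - s"
    "w$a = s" "w$b = 0" "w$c = - s" "\<bar>s\<bar> \<le> 1/5"
proof -
  note segs = row_segments[OF assms]
  have pts: "x \<in> S" "x + 5 *\<^sub>R v \<in> S" "x + w \<in> S" using segs(1) segs(2)[of 0] by auto
  have sums: "v$1 + v$2 + v$3 = 0" "w$1 + w$2 + w$3 = 0"
    using total[OF pts(1)] total[OF pts(2)] total[OF pts(3)] by auto
  have dirs: "\<exists>i. v$i = 0" "\<exists>i. w$i = 0" "\<exists>i. v$i = w$i"
    using segment_constant_coordinate[OF segs(1)] segment_constant_coordinate[OF segs(2)[of 0]]
      segment_constant_coordinate[OF segs(3)[of 0]] by auto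
  have norms: "norm w = norm v" "norm (v - w) = norm v" "v \<noteq> 0"
    using assms unfolding row_def by auto
  obtain a b c s where *: "distinct [a, b, c]" "s \<noteq> 0" "v$a = 0" "v$b = s" "v$c = - s"
    "w$a = s" "w$b = 0" "w$c = - s"
    by (rule equilateral_directions[OF sums dirs norms])
  have "0 \<le> x$b" "x$b \<le> 1" "0 \<le> x$b + 5 * s" "x$b + 5 * s \<le> 1"
    using nonneg[OF pts(1), of b] le_1[OF pts(1), of b] nonneg[OF pts(2), of b]
      le_1[OF pts(2), of b] * by auto
  then have "\<bar>s\<bar> \<le> 1/5" by linarith
  with * that show thesis by blast
qed

text \<open>Choose \<open>n\<close> with \<open>1/2^(n+1) < s \<le> 1/2^n\<close>.  The edges along \<open>w\<close> of the first two triangles are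
  longer than \<open>1/2^(n+1)\<close>, so their feet are multiples of \<open>1/2^n\<close>, and so is the distance \<open>s\<close> between them.\<close>
lemma row_on_side:
  assumes row: "row x v w" and d: "distinct [a, b, c]" and "s \<noteq> 0"
    and v: "v$a = 0" "v$b = s" "v$c = - s" and w: "w$a = s" "w$b = 0" "w$c = - s"
    and "\<bar>s\<bar> \<le> 1/5" and xa: "x$a = 0"
  shows "\<exists>n. s = 1/2^n"
proof -
  note segs = row_segments[OF row]
  have "0 \<le> (x + w)$a" using segs(2)[of 0] by (intro nonneg) auto
  then have s: "0 < s" "s \<le> 1" using assms w xa by auto
  define n where "n = (LEAST n. 1/2^(Suc n) < s)"
  have "\<exists>n. 1/2^(Suc n) < s"
  proof -
    obtain m where "(1/2)^m < s" using real_arch_pow_inv[of s "1/2"] s by auto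
    moreover have "(1/2::real)^(Suc m) \<le> (1/2)^m" by simp
    ultimately show ?thesis by (intro exI[of _ m]) (simp add: power_one_over)
  qed
  then have n1: "1/2^(Suc n) < s" unfolding n_def by (rule LeastI_ex)
  have n2: "s \<le> 1/2^n"
  proof (cases n)
    case 0 then show ?thesis using s by simp
  next
    case (Suc l)
    then have "\<not> 1/2^(Suc l) < s" using not_less_Least[of l "\<lambda>n. 1/2^(Suc n) < s"] n_def by auto
    then show ?thesis using Suc by simp
  qed
  have "2^n * x$b \<in> \<int>"
    using segs(2)[of 0] d xa w v n1 by (intro dyadic_start[of x "x + w" a b c]) auto
  moreover have "2^n * (x + v)$b \<in> \<int>"
    using segs(2)[of 1] d xa w v n1 by (intro dyadic_start[of "x + v" "x + v + w" a b c]) auto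
  ultimately have "2^n * (x + v)$b - 2^n * x$b \<in> \<int>" by (rule Ints_diff[rotated])
  then have "2^n * s \<in> \<int>" using v by (simp add: algebra_simps)
  moreover have "0 < 2^n * s" "2^n * s < 2"
    using n2 s by (auto simp: field_simps)
  ultimately have "2^n * s = 1" by (auto elim!: Ints_cases)
  then show ?thesis by (intro exI[of _ n]) (simp add: field_simps)
qed

text \<open>If the base lies in corner \<open>i\<close> but an apex does not, both edges leading to that apex leave the
  corner.  Each then runs along a side of the simplex or starts at a contact point of two corners,
  and every combination is either contradictory or gives the triangle size at least \<open>1/2\<close>, too
  large for five in a row.\<close>
lemma row_in_corner:
  assumes row: "row x v w" and d: "distinct [a, b, c]" and "s \<noteq> 0"
    and v: "v$a = 0" "v$b = s" "v$c = - s" and w: "w$a = s" "w$b = 0" "w$c = - s"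
    and s5: "\<bar>s\<bar> \<le> 1/5" and base: "1/2 \<le> x$i" "1/2 \<le> (x + 5 *\<^sub>R v)$i"
    and m: "m < 5"
  shows "1/2 \<le> (x + real m *\<^sub>R v)$i" "1/2 \<le> (x + real (Suc m) *\<^sub>R v)$i"
    "1/2 \<le> (x + real m *\<^sub>R v + w)$i"
proof -
  note segs = row_segments[OF row]
  have between: "1/2 \<le> (x + t *\<^sub>R v)$i" if "0 \<le> t" "t \<le> 5" for t
  proof -
    have "(1 - t/5) * (1/2) \<le> (1 - t/5) * x$i" "t/5 * (1/2) \<le> t/5 * (x + 5 *\<^sub>R v)$i"
      using that base by (intro mult_left_mono; simp)+
    then show ?thesis by (simp add: algebra_simps)
  qed
  define p where "p = x + real m *\<^sub>R v"
  define y where "y = p + w"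
  have p': "x + real (Suc m) *\<^sub>R v = p + v" by (simp add: p_def algebra_simps)
  show p: "1/2 \<le> (x + real m *\<^sub>R v)$i" and q: "1/2 \<le> (x + real (Suc m) *\<^sub>R v)$i"
    using between[of "real m"] between[of "real (Suc m)"] m by auto
  have sg: "closed_segment p y \<subseteq> S" "closed_segment (p + v) y \<subseteq> S"
    using segs(2)[OF m] segs(3)[OF m] unfolding p' p_def[symmetric] y_def by auto
  have pS: "p \<in> S" and qS: "p + v \<in> S" and yS: "y \<in> S" using sg by auto
  note facts = total_distinct[OF pS d] total_distinct[OF qS d] total_distinct[OF yS d]
    nonneg[OF pS, of a] nonneg[OF pS, of b] nonneg[OF pS, of c]
    nonneg[OF qS, of a] nonneg[OF qS, of b] nonneg[OF qS, of c]
    nonneg[OF yS, of a] nonneg[OF yS, of b] nonneg[OF yS, of c]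
  have coords: "y$a = p$a + s" "y$b = p$b" "y$c = p$c - s"
    "(p + v)$a = p$a" "(p + v)$b = p$b + s" "(p + v)$c = p$c - s"
    by (simp_all add: y_def v w)
  have cases: "(1/2 \<le> r$a \<and> 1/2 \<le> y$a) \<or> (1/2 \<le> r$b \<and> 1/2 \<le> y$b) \<or> (1/2 \<le> r$c \<and> 1/2 \<le> y$c) \<or>
      (r$a = 0 \<and> y$a = 0) \<or> (r$b = 0 \<and> y$b = 0) \<or> (r$c = 0 \<and> y$c = 0)"
    if "closed_segment r y \<subseteq> S" for r
    using segment_in_corner_or_on_side[OF that]
  proof (elim disjE exE)
    fix n assume "1/2 \<le> r$n \<and> 1/2 \<le> y$n"
    then show ?thesis using three_indices[OF d, of n] by auto
  next
    fix n assume "r$n = 0 \<and> y$n = 0"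
    then show ?thesis using three_indices[OF d, of n] by auto
  qed
  note numeric = cases[OF sg(1), unfolded coords] cases[OF sg(2), unfolded coords]
    facts[unfolded coords] s5 \<open>s \<noteq> 0\<close>
  have "1/2 \<le> y$a" if "1/2 \<le> p$a" "1/2 \<le> (p + v)$a"
    using that numeric unfolding coords by (elim disjE conjE; linarith)
  moreover have "1/2 \<le> y$b" if "1/2 \<le> p$b" "1/2 \<le> (p + v)$b"
    using that numeric unfolding coords by (elim disjE conjE; linarith)
  moreover have "1/2 \<le> y$c" if "1/2 \<le> p$c" "1/2 \<le> (p + v)$c"
    using that numeric unfolding coords by (elim disjE conjE; linarith)
  ultimately have "1/2 \<le> y$i"
    using three_indices[OF d, of i] p q unfolding p' p_def[symmetric] by blast
  then show "1/2 \<le> (x + real m *\<^sub>R v + w)$i" unfolding y_def p_def by simp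
qed

end

section \<open>A point avoided by all rows\<close>

text \<open>
  This point is the fixed point of \<open>shrink i \<circ> shrink j \<circ> shrink k\<close>: its nested triangles circle around
  the three corners, so it stays away from long rows at every scale.\<close>
definition spiral_point :: "3 \<Rightarrow> 3 \<Rightarrow> 3 \<Rightarrow> real^3" where
  "spiral_point i j k = (4/7) *\<^sub>R axis i 1 + (2/7) *\<^sub>R axis j 1 + (1/7) *\<^sub>R axis k 1"

lemma shrink_spiral_point: "shrink i (spiral_point j k i) = spiral_point i j k"
  by (simp add: shrink_def spiral_point_def scaleR_right_distrib algebra_simps flip: scaleR_left_distrib)

lemma zoom_shrink [simp]: "zoom i (shrink i p) = p"
  by (simp add: zoom_def shrink_def)

lemma spiral_point_nth:
  assumes "distinct [i, j, k]"
  shows "spiral_point i j k $ i = 4/7" "spiral_point i j k $ j = 2/7" "spiral_point i j k $ k = 1/7"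
  using assms by (auto simp: spiral_point_def axis_def)

lemma zoom_row_hull:
  assumes "p \<in> row_hull x v w"
  shows "zoom i p \<in> row_hull (zoom i x) (2 *\<^sub>R v) (2 *\<^sub>R w)"
proof -
  obtain m \<alpha> \<beta> where *: "p = x + (real m + \<alpha>) *\<^sub>R v + \<beta> *\<^sub>R w"
    "m < 5" "0 \<le> \<alpha>" "0 \<le> \<beta>" "\<alpha> + \<beta> \<le> 1"
    using assms unfolding row_hull_def by blast
  have "zoom i p = zoom i x + (real m + \<alpha>) *\<^sub>R (2 *\<^sub>R v) + \<beta> *\<^sub>R (2 *\<^sub>R w)"
    unfolding *(1) by (simp add: vec_eq_iff zoom_nth algebra_simps)
  then show ?thesis using * unfolding row_hull_def by blast
qed

lemma no_half_power_between: "\<not> (1/2^(Suc k) < (1/2^n :: real) \<and> 1/2^n < (1/2^k :: real))"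
proof (intro notI, elim conjE)
  assume "1/2^(Suc k) < (1/2^n :: real)" "1/2^n < (1/2^k :: real)"
  then have "(2::real)^n < 2^(Suc k)" "(2::real)^k < 2^n" by (simp_all add: frac_less2 field_simps)
  then have "n < Suc k" "k < n"
    using power_strict_increasing_iff[of "2::real" n "Suc k"]
      power_strict_increasing_iff[of "2::real" k n] by (simp_all del: power_Suc)
  then show False by simp
qed

context zoomable
begin

lemma row_size:
  assumes "row x v w"
  shows "norm v \<le> 1"
proof -
  obtain a b c s where *: "distinct [a, b, c]" "s \<noteq> 0" "v$a = 0" "v$b = s" "v$c = - s"
    "w$a = s" "w$b = 0" "w$c = - s" "\<bar>s\<bar> \<le> 1/5" using assms by (rule row_directions)
  have "(norm v)\<^sup>2 = 2 * s\<^sup>2" by (rule norm_side_direction[OF *(1,3-5)])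
  also have "s\<^sup>2 \<le> (1/5)\<^sup>2" using *(9) by (metis abs_ge_zero power2_abs power_mono)
  finally have "(norm v)\<^sup>2 \<le> 1\<^sup>2" by (simp add: power2_eq_square)
  then show ?thesis by (rule power2_le_imp_le) simp
qed

lemma zoom_row:
  assumes row: "row x v w"
    and corners: "\<And>m. m < 5 \<Longrightarrow> 1/2 \<le> (x + real m *\<^sub>R v)$i"
      "\<And>m. m < 5 \<Longrightarrow> 1/2 \<le> (x + real (Suc m) *\<^sub>R v)$i"
      "\<And>m. m < 5 \<Longrightarrow> 1/2 \<le> (x + real m *\<^sub>R v + w)$i"
  shows "row (zoom i x) (2 *\<^sub>R v) (2 *\<^sub>R w)"
proof -
  note segs = row_segments[OF row]
  have base: "1/2 \<le> x$i" "1/2 \<le> (x + 5 *\<^sub>R v)$i"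
    using corners(1)[of 0] corners(2)[of 4] by simp_all
  have lin: "zoom i (x + t *\<^sub>R v + r *\<^sub>R w) = zoom i x + t *\<^sub>R (2 *\<^sub>R v) + r *\<^sub>R (2 *\<^sub>R w)" for t r
    by (simp add: vec_eq_iff zoom_nth algebra_simps)
  have "closed_segment (zoom i x) (zoom i x + 5 *\<^sub>R (2 *\<^sub>R v)) \<subseteq> S"
    using zoom_segment[OF segs(1) base] lin[of 5 0] by simp
  moreover have "closed_segment (zoom i x + real m *\<^sub>R (2 *\<^sub>R v)) (zoom i x + real m *\<^sub>R (2 *\<^sub>R v) + 2 *\<^sub>R w) \<subseteq> S"
    if "m < 5" for m
    using zoom_segment[OF segs(2)[OF that] corners(1,3)[OF that]] lin[of "real m" 0] lin[of "real m" 1]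
    by simp
  moreover have "closed_segment (zoom i x + real (Suc m) *\<^sub>R (2 *\<^sub>R v)) (zoom i x + real m *\<^sub>R (2 *\<^sub>R v) + 2 *\<^sub>R w) \<subseteq> S"
    if "m < 5" for m
    using zoom_segment[OF segs(3)[OF that] corners(2,3)[OF that]] lin[of "real (Suc m)" 0]
      lin[of "real m" 1]
    by (simp del: of_nat_Suc)
  ultimately have "row_frame (zoom i x) (2 *\<^sub>R v) (2 *\<^sub>R w) \<subseteq> S"
    unfolding row_frame_def by blast
  moreover have "norm (2 *\<^sub>R v - 2 *\<^sub>R w) = 2 * norm (v - w)"
    using norm_scaleR[of 2 "v - w"] by (simp add: scaleR_diff_right)
  ultimately show ?thesis using row unfolding row_def by simp
qed

lemma row_hull_in_corner:
  assumes p: "p \<in> row_hull x v w"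
    and corners: "\<And>m. m < 5 \<Longrightarrow> 1/2 \<le> (x + real m *\<^sub>R v)$i"
      "\<And>m. m < 5 \<Longrightarrow> 1/2 \<le> (x + real (Suc m) *\<^sub>R v)$i"
      "\<And>m. m < 5 \<Longrightarrow> 1/2 \<le> (x + real m *\<^sub>R v + w)$i"
  shows "1/2 \<le> p$i"
proof -
  obtain m \<alpha> \<beta> where *: "p = x + (real m + \<alpha>) *\<^sub>R v + \<beta> *\<^sub>R w"
    "m < 5" "0 \<le> \<alpha>" "0 \<le> \<beta>" "\<alpha> + \<beta> \<le> 1"
    using p unfolding row_hull_def by blast
  have "(1 - \<alpha> - \<beta>) * (1/2) + \<alpha> * (1/2) + \<beta> * (1/2) \<le>
      (1 - \<alpha> - \<beta>) * (x + real m *\<^sub>R v)$i + \<alpha> * (x + real (Suc m) *\<^sub>R v)$i + \<beta> * (x + real m *\<^sub>R v + w)$i"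
    using corners[OF *(2)] * by (intro add_mono mult_left_mono) simp_all
  also have "\<dots> = p$i" unfolding *(1) by (simp add: algebra_simps)
  finally show ?thesis by argo
qed

text \<open>By the dichotomy for segments, the base of the row lies in a corner or on a side.  A base in a
  corner pulls the whole row into it; a base on a side makes the size of the row a power of \<open>1/2\<close>, and
  this size is also the height that the row reaches above the side.\<close>
lemma row_dichotomy:
  assumes row: "row x v w"
  obtains (side) a n where "1/2^n \<le> (1/5::real)" "(norm v)\<^sup>2 = 2 * (1/2^n)\<^sup>2"
      "\<And>p. p \<in> row_hull x v w \<Longrightarrow> p$a \<le> 1/2^n"
  | (corner) i where "\<And>p. p \<in> row_hull x v w \<Longrightarrow> 1/2 \<le> p$i"
      "row (zoom i x) (2 *\<^sub>R v) (2 *\<^sub>R w)"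
proof -
  obtain a b c s where *: "distinct [a, b, c]" "s \<noteq> 0" "v$a = 0" "v$b = s" "v$c = - s"
    "w$a = s" "w$b = 0" "w$c = - s" "\<bar>s\<bar> \<le> 1/5" using row by (rule row_directions)
  show thesis
    using segment_in_corner_or_on_side[OF row_segments(1)[OF row]]
  proof (elim disjE exE conjE)
    fix i assume i: "1/2 \<le> x$i" "1/2 \<le> (x + 5 *\<^sub>R v)$i"
    note corners = row_in_corner[OF row * i]
    show thesis
      by (rule corner[of i]) (use row_hull_in_corner corners zoom_row[OF row] in blast)+
  next
    fix i assume i: "x$i = 0" "(x + 5 *\<^sub>R v)$i = 0"
    then have "v$i = 0" by simp
    then have "i = a" using three_indices[OF *(1), of i] * by auto
    then have xa: "x$a = 0" using i by simp
    obtain n where n: "s = 1/2^n" using row_on_side[OF row * xa] by blast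
    show thesis
    proof (rule side[of n a])
      show "1/2^n \<le> (1/5::real)" using n *(9) by simp
      show "(norm v)\<^sup>2 = 2 * (1/2^n)\<^sup>2" using norm_side_direction[OF *(1,3-5)] n by simp
      fix p assume "p \<in> row_hull x v w"
      then obtain m \<alpha> \<beta> where p: "p = x + (real m + \<alpha>) *\<^sub>R v + \<beta> *\<^sub>R w"
        "m < 5" "0 \<le> \<alpha>" "0 \<le> \<beta>" "\<alpha> + \<beta> \<le> 1"
        unfolding row_hull_def by blast
      have "p$a = \<beta> * s" unfolding p(1) using xa * by simp
      also have "\<dots> \<le> 1 * s" using p n by (intro mult_right_mono) auto
      finally show "p$a \<le> 1/2^n" using n by simp
    qed
  qed
qed

text \<open>A row of size at most \<open>1/5\<close> standing on a side has size at most \<open>1/8 < 1/7\<close> and does not reach the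
  point, so every row around the point lies in the corner of the point.  Zooming there gives a row of
  double size around the point with cyclically shifted corners, and the process never stops.\<close>
lemma spiral_point_not_in_row_hull:
  assumes "row x v w" "distinct [i, j, k]"
  shows "spiral_point i j k \<notin> row_hull x v w"
proof
  assume *: "spiral_point i j k \<in> row_hull x v w"
  have bound: "2^n * norm v \<le> 1"
    if "row x v w" "distinct [i, j, k]" "spiral_point i j k \<in> row_hull x v w" for n x v w i j k
    using that
  proof (induction n arbitrary: x v w i j k)
    case 0
    then show ?case using row_size by simp
  next
    case (Suc n)
    note d = Suc.prems(2) and p = Suc.prems(3)
    note nth = spiral_point_nth[OF d]
    show ?case
    proof (rule row_dichotomy[OF Suc.prems(1)])
      fix a l assume l: "1/2^l \<le> (1/5::real)" "\<And>p. p \<in> row_hull x v w \<Longrightarrow> p$a \<le> 1/2^l"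
      have "1/7 \<le> spiral_point i j k $ a" using three_indices[OF d, of a] nth by auto
      then have "1/7 \<le> (1/2^l::real)" by (rule order_trans[OF _ l(2)[OF p]])
      then show ?case using no_half_power_between[of 2 l] l by simp
    next
      fix h assume h: "\<And>p. p \<in> row_hull x v w \<Longrightarrow> 1/2 \<le> p$h"
        and row: "row (zoom h x) (2 *\<^sub>R v) (2 *\<^sub>R w)"
      have "h = i" using three_indices[OF d, of h] nth h[OF p] by auto
      moreover have "zoom i (spiral_point i j k) = spiral_point j k i"
        using zoom_shrink[of i "spiral_point j k i"] unfolding shrink_spiral_point .
      ultimately have "spiral_point j k i \<in> row_hull (zoom h x) (2 *\<^sub>R v) (2 *\<^sub>R w)"
        using zoom_row_hull[OF p, of h] by simp
      from Suc.IH[OF row _ this] d show ?case by (auto simp: mult.assoc mult.left_commute)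
    qed
  qed
  have pos: "0 < norm v" using assms unfolding row_def by simp
  obtain n :: nat where "1 / norm v < 2^n" using real_arch_pow[of 2] by auto
  then have "1 < 2^n * norm v" using pos by (simp add: field_simps)
  then show False using bound[OF assms *, of n] by simp
qed

text \<open>Rows of size less than \<open>1/8\<close> on a side have size at most \<open>1/16\<close>, whereas every coordinate of the
  point is at least \<open>1/14\<close>.  Any other row around the point is carried by one zoom to a row around
  \<open>spiral_point i j k\<close>.\<close>
lemma small_row_misses_point:
  assumes row: "row x v w" and small: "(norm v)\<^sup>2 < 2 * (1/8)\<^sup>2" and d: "distinct [i, j, k]"
  shows "shrink j (spiral_point i j k) \<notin> row_hull x v w"
proof
  assume p: "shrink j (spiral_point i j k) \<in> row_hull x v w"
  have nth: "shrink j (spiral_point i j k) $ i = 2/7" "shrink j (spiral_point i j k) $ j = 9/14"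
    "shrink j (spiral_point i j k) $ k = 1/14"
    using spiral_point_nth[OF d] d by (auto simp: shrink_nth)
  show False
  proof (rule row_dichotomy[OF row])
    fix a l assume l: "1/2^l \<le> (1/5::real)" "(norm v)\<^sup>2 = 2 * (1/2^l)\<^sup>2"
      "\<And>p. p \<in> row_hull x v w \<Longrightarrow> p$a \<le> 1/2^l"
    have "1/14 \<le> shrink j (spiral_point i j k) $ a" using three_indices[OF d, of a] nth by auto
    then have "1/14 \<le> (1/2^l::real)" by (rule order_trans[OF _ l(3)[OF p]])
    moreover have "(1/2^l::real) < 1/8"
    proof (rule power2_less_imp_less)
      show "(1/2^l::real)\<^sup>2 < (1/8)\<^sup>2" using small unfolding l(2) by simp
    qed simp
    ultimately show False using no_half_power_between[of 3 l] by simp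
  next
    fix h assume h: "\<And>p. p \<in> row_hull x v w \<Longrightarrow> 1/2 \<le> p$h"
      and row': "row (zoom h x) (2 *\<^sub>R v) (2 *\<^sub>R w)"
    have "h = j" using three_indices[OF d, of h] nth h[OF p] by auto
    then have "spiral_point i j k \<in> row_hull (zoom h x) (2 *\<^sub>R v) (2 *\<^sub>R w)"
      using zoom_row_hull[OF p, of h] by simp
    then show False using spiral_point_not_in_row_hull[OF row' d] by blast
  qed
qed

end

section \<open>The Sierpinski gasket in barycentric coordinates\<close>

text \<open>The coordinates belong to the lower left, the top and the lower right vertex, in this order.\<close>
definition bary :: "real^2 \<Rightarrow> real^3" where
  "bary p = vector [1 - p$1 - p$2 / sqrt 3, 2 * p$2 / sqrt 3, p$1 - p$2 / sqrt 3]"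

lemma bary_nth:
  "bary p $ 1 = 1 - p$1 - p$2 / sqrt 3" "bary p $ 2 = 2 * p$2 / sqrt 3" "bary p $ 3 = p$1 - p$2 / sqrt 3"
  by (simp_all add: bary_def vector_3)

lemma norm_bary_diff: "norm (bary p - bary q) = sqrt 2 * norm (p - q)"
proof -
  have quadratic: "(a + d)\<^sup>2 + (2 * d)\<^sup>2 + (a - d)\<^sup>2 = 2 * a\<^sup>2 + 6 * d\<^sup>2" for a d :: real
    by (simp add: power2_eq_square algebra_simps)
  have "(norm (bary p - bary q))\<^sup>2 = (bary p$1 - bary q$1)\<^sup>2 + (bary p$2 - bary q$2)\<^sup>2 + (bary p$3 - bary q$3)\<^sup>2"
    by (simp add: norm_vec_def L2_set_def sum_3)
  also have "\<dots> = (p$1 - q$1 + (p$2 - q$2) / sqrt 3)\<^sup>2 + (2 * ((p$2 - q$2) / sqrt 3))\<^sup>2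
      + (p$1 - q$1 - (p$2 - q$2) / sqrt 3)\<^sup>2"
    unfolding bary_nth by (simp add: diff_divide_distrib power2_eq_square algebra_simps)
  also have "\<dots> = 2 * (p$1 - q$1)\<^sup>2 + 6 * ((p$2 - q$2) / sqrt 3)\<^sup>2"
    by (rule quadratic)
  also have "\<dots> = 2 * ((p$1 - q$1)\<^sup>2 + (p$2 - q$2)\<^sup>2)"
    by (simp add: power_divide)
  also have "\<dots> = (sqrt 2 * norm (p - q))\<^sup>2"
    by (simp add: norm_vec_def L2_set_def sum_2 power_mult_distrib)
  finally show ?thesis by (rule power2_eq_imp_eq) simp_all
qed

lemma bary_inject: "bary p = bary q \<Longrightarrow> p = q"
  using norm_bary_diff[of p q] by simp

lemma bary_affine: "bary ((1 - t) *\<^sub>R p + t *\<^sub>R q) = (1 - t) *\<^sub>R bary p + t *\<^sub>R bary q"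
  by (simp add: vec_eq_iff forall_3 bary_nth add_divide_distrib diff_divide_distrib algebra_simps)

definition corner_point :: "3 \<Rightarrow> real^2" where
  "corner_point i = (if i = 1 then 0 else if i = 2 then vector [1/2, sqrt 3 / 2] else vector [1, 0])"

lemma bary_corner_point: "bary (corner_point i) = axis i 1"
  using exhaust_3[of i]
  by (auto simp: vec_eq_iff forall_3 bary_nth corner_point_def axis_def vector_2)

lemma gasket_invariant:
  "sierpinski_gasket \<noteq> {}" "compact sierpinski_gasket"
  "sierpinski_gasket = (\<Union>f\<in>set gasket_ifs. f ` sierpinski_gasket)"
  using attractor_eq_iff[of gasket_ifs sierpinski_gasket] gasket_ifs_contractive
  by (simp_all add: sierpinski_gasket_def gasket_ifs_def)

definition bary_gasket :: "(real^3) set" where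
  "bary_gasket = bary ` sierpinski_gasket"

lemma bary_gasket_iff: "bary p \<in> bary_gasket \<longleftrightarrow> p \<in> sierpinski_gasket"
  unfolding bary_gasket_def using bary_inject by blast

lemma bary_gasket_invariant: "bary_gasket = (\<Union>i. shrink i ` bary_gasket)"
proof -
  have "bary ((1/2) *\<^sub>R p) = shrink 1 (bary p)"
    "bary ((1/2) *\<^sub>R p + vector [1/4, sqrt 3 / 4]) = shrink 2 (bary p)"
    "bary ((1/2) *\<^sub>R p + vector [1/2, 0]) = shrink 3 (bary p)" for p
    by (simp_all add: vec_eq_iff forall_3 bary_nth shrink_nth vector_2 field_simps)
  then have "bary ` (\<Union>f\<in>set gasket_ifs. f ` sierpinski_gasket) = (\<Union>i. shrink i ` bary_gasket)"
    unfolding gasket_ifs_def bary_gasket_def by (simp add: UNIV_3 image_Un image_image)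
  then show ?thesis by (simp only: gasket_invariant(3)[symmetric] bary_gasket_def)
qed

lemma compact_bary_gasket: "compact bary_gasket" "bary_gasket \<noteq> {}"
proof -
  have "continuous_on sierpinski_gasket bary"
    by (rule lipschitz_on_continuous_on[of "sqrt 2"])
       (simp add: lipschitz_on_def dist_norm norm_bary_diff)
  then show "compact bary_gasket"
    unfolding bary_gasket_def using gasket_invariant(2) by (rule compact_continuous_image)
  show "bary_gasket \<noteq> {}" unfolding bary_gasket_def using gasket_invariant(1) by simp
qed

lemma shrink_in_bary_gasket: "p \<in> bary_gasket \<Longrightarrow> shrink i p \<in> bary_gasket"
  by (subst bary_gasket_invariant) blast

lemma bary_gasket_cases:
  assumes "p \<in> bary_gasket"
  obtains i b where "b \<in> bary_gasket" "p = shrink i b"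
  using assms eqset_imp_iff[OF bary_gasket_invariant, of p] by blast

text \<open>This is how points are shown to lie in the gasket.  At a point of \<open>K\<close> farthest from the gasket,
  undoing one contraction leads to a point of \<open>K\<close> at least twice as far away, so the distance is zero.\<close>
lemma self_covering_subset_bary_gasket:
  assumes "compact K" and cover: "K \<subseteq> (\<Union>i. shrink i ` K)"
  shows "K \<subseteq> bary_gasket"
proof (cases "K = {}")
  case False
  note G = compact_imp_closed[OF compact_bary_gasket(1)] compact_bary_gasket(2)
  obtain a where a: "a \<in> K" and max: "\<And>x. x \<in> K \<Longrightarrow> infdist x bary_gasket \<le> infdist a bary_gasket"
    using continuous_attains_sup[OF assms(1) False, of "\<lambda>x. infdist x bary_gasket"]
      continuous_on_infdist[of K "\<lambda>x. x"] by auto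
  obtain i a' where a': "a' \<in> K" "a = shrink i a'" using a cover by blast
  obtain b where b: "b \<in> bary_gasket" "infdist a' bary_gasket = dist a' b"
    using infdist_attains_inf[OF G] by metis
  have "infdist a bary_gasket \<le> dist a (shrink i b)"
    using shrink_in_bary_gasket[OF b(1)] by (rule infdist_le)
  also have "a - shrink i b = (1/2) *\<^sub>R (a' - b)"
    unfolding a' by (simp add: shrink_def algebra_simps)
  then have "dist a (shrink i b) = infdist a' bary_gasket / 2" by (simp add: dist_norm b)
  also have "\<dots> \<le> infdist a bary_gasket / 2" using max[OF a'(1)] by simp
  finally have z: "infdist a bary_gasket \<le> 0" by simp
  show ?thesis
  proof
    fix x assume "x \<in> K"
    then have "infdist x bary_gasket = 0" using max z infdist_nonneg[of x bary_gasket] by fastforce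
    then show "x \<in> bary_gasket" using in_closed_iff_infdist_zero[OF G] by simp
  qed
qed simp

lemma side_subset_bary_gasket: "closed_segment (axis i 1) (axis j 1) \<subseteq> bary_gasket"
proof (rule self_covering_subset_bary_gasket)
  show "closed_segment (axis i 1) (axis j (1::real)) \<subseteq>
      (\<Union>k. shrink k ` closed_segment (axis i 1) (axis j 1))"
  proof
    fix p :: "real^3" assume "p \<in> closed_segment (axis i 1) (axis j 1)"
    then obtain t where t: "0 \<le> t" "t \<le> 1" "p = (1 - t) *\<^sub>R axis i 1 + t *\<^sub>R axis j 1"
      unfolding in_segment by blast
    show "p \<in> (\<Union>k. shrink k ` closed_segment (axis i 1) (axis j 1))"
    proof (cases "t \<le> 1/2")
      case True
      have "p = shrink i ((1 - 2*t) *\<^sub>R axis i 1 + (2*t) *\<^sub>R axis j 1)"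
        unfolding t by (simp add: vec_eq_iff shrink_nth field_simps) (simp add: axis_def)
      moreover have "(1 - 2*t) *\<^sub>R axis i 1 + (2*t) *\<^sub>R axis j 1 \<in> closed_segment (axis i 1) (axis j (1::real))"
        unfolding in_segment using True t by (intro exI[of _ "2*t"]) auto
      ultimately show ?thesis by blast
    next
      case False
      have "p = shrink j ((1 - (2*t - 1)) *\<^sub>R axis i 1 + (2*t - 1) *\<^sub>R axis j 1)"
        unfolding t by (simp add: vec_eq_iff shrink_nth field_simps) (simp add: axis_def)
      moreover have "(1 - (2*t - 1)) *\<^sub>R axis i 1 + (2*t - 1) *\<^sub>R axis j 1 \<in> closed_segment (axis i 1) (axis j (1::real))"
        unfolding in_segment using False t by (intro exI[of _ "2*t - 1"]) auto
      ultimately show ?thesis by blast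
    qed
  qed
qed simp

lemma spiral_point_in_bary_gasket: "spiral_point i j k \<in> bary_gasket"
proof -
  have "{spiral_point i j k, spiral_point j k i, spiral_point k i j} \<subseteq> bary_gasket"
    using shrink_spiral_point[of i j k] shrink_spiral_point[of j k i] shrink_spiral_point[of k i j]
    by (intro self_covering_subset_bary_gasket) (auto simp: image_iff, metis+)
  then show ?thesis by simp
qed

lemma bary_sum: "bary p $ 1 + bary p $ 2 + bary p $ 3 = 1"
  by (simp add: bary_nth)

text \<open>Where a coordinate attains its minimum \<open>a\<close>, undoing one contraction gives a value of at most \<open>2 a\<close>
  that is again at least \<open>a\<close>; hence \<open>a \<ge> 0\<close>.\<close>
lemma bary_gasket_nonneg:
  assumes "p \<in> bary_gasket"
  shows "0 \<le> p$i"
proof -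
  have cont: "continuous_on bary_gasket (\<lambda>x. x$i)" by (intro continuous_intros)
  obtain a where a: "a \<in> bary_gasket" and min: "\<And>x. x \<in> bary_gasket \<Longrightarrow> a$i \<le> x$i"
    using continuous_attains_inf[OF compact_bary_gasket cont] by blast
  obtain j b where b: "b \<in> bary_gasket" "a = shrink j b" using a by (rule bary_gasket_cases)
  have "0 \<le> a$i" using min[OF b(1)] unfolding b(2) by (simp add: shrink_nth split: if_splits)
  then show ?thesis using min[OF assms] by simp
qed

interpretation gasket: zoomable bary_gasket
proof
  fix p i assume p: "p \<in> bary_gasket"
  show "0 \<le> p$i" using p by (rule bary_gasket_nonneg)
  show "p$1 + p$2 + p$3 = 1" using p bary_sum unfolding bary_gasket_def by blast
  obtain j b where b: "b \<in> bary_gasket" "p = shrink j b" using p by (rule bary_gasket_cases)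
  have nn: "0 \<le> b$n" for n using b(1) by (rule bary_gasket_nonneg)
  show "\<exists>i. 1/2 \<le> p$i" using nn[of j] b(2) by (intro exI[of _ j]) (simp add: shrink_nth)
  show "zoom i p \<in> bary_gasket" if "1/2 \<le> p$i"
  proof (cases "j = i")
    case True
    then show ?thesis using b by simp
  next
    case False
    \<comment> \<open>The point \<open>p\<close> was reached through another corner \<open>j\<close>, so it is the contact point of the
      corners \<open>i\<close> and \<open>j\<close>, and zooming into \<open>i\<close> sends it to the vertex \<open>j\<close>.\<close>
    then obtain k where d: "distinct [i, j, k]" using remaining_index by metis
    have "b$i + b$j + b$k = 1"
      using sum_three_indices[OF d, of b] b(1) bary_sum unfolding bary_gasket_def by auto
    moreover have "1 \<le> b$i" using that False unfolding b(2) by (simp add: shrink_nth)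
    ultimately have "b$i = 1" "b$j = 0" "b$k = 0" using nn[of j] nn[of k] by linarith+
    then have "b$n = axis i 1 $ n" for n using three_indices[OF d, of n] d by (auto simp: axis_def)
    then have "zoom i p = axis j 1" unfolding b(2) by (simp add: vec_eq_iff zoom_nth shrink_nth) (simp add: axis_def)
    then show ?thesis using side_subset_bary_gasket[of j j] by simp
  qed
qed

section \<open>Similar copies of five-Sierpinski\<close>

text \<open>
  Shrinking by \<open>1/8\<close> towards the lower left vertex puts the five gaskets onto the first five of the eight
  triangles along the bottom of the third subdivision.  Having everything inside one gasket
  avoids a separate analysis of segments that cross from one of the five gaskets to the next.\<close>
definition into_gasket :: "real^2 \<Rightarrow> real^3" where
  "into_gasket p = shrink 1 (shrink 1 (shrink 1 (bary p)))"

lemma into_gasket_eq: "into_gasket p = (1/8) *\<^sub>R (bary p + 7 *\<^sub>R axis 1 1)"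
  by (simp add: into_gasket_def shrink_def algebra_simps vec_eq_iff)

text \<open>The bottom triangle number \<open>j\<close> has the binary digits of \<open>j\<close> as its address, with the left corner for
  digit 0 and the right corner for digit 1.\<close>
lemma into_gasket_translate:
  "into_gasket (p + vector [1, 0]) = shrink 1 (shrink 1 (shrink 3 (bary p)))"
  "into_gasket (p + vector [2, 0]) = shrink 1 (shrink 3 (shrink 1 (bary p)))"
  "into_gasket (p + vector [3, 0]) = shrink 1 (shrink 3 (shrink 3 (bary p)))"
  "into_gasket (p + vector [4, 0]) = shrink 3 (shrink 1 (shrink 1 (bary p)))"
  by (simp_all add: vec_eq_iff forall_3 into_gasket_eq shrink_nth bary_nth axis_def vector_2)

lemma five_sierpinski_iff:
  "p \<in> five_sierpinski \<longleftrightarrow> (\<exists>j\<le>4. \<exists>q\<in>sierpinski_gasket. p = q + vector [real j, 0])"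
  unfolding five_sierpinski_def by auto

lemma into_gasket_five_sierpinski:
  assumes "p \<in> five_sierpinski"
  shows "into_gasket p \<in> bary_gasket"
proof -
  obtain j q where jq: "j \<le> 4" "q \<in> sierpinski_gasket" "p = q + vector [real j, 0]"
    using assms five_sierpinski_iff by blast
  have z: "vector [0, 0] = (0::real^2)" by (simp add: vec_eq_iff forall_2)
  have q: "bary q \<in> bary_gasket" using jq bary_gasket_iff by simp
  have "j = 0 \<or> j = 1 \<or> j = 2 \<or> j = 3 \<or> j = 4" using jq(1) by linarith
  then show ?thesis
    unfolding jq(3) using into_gasket_translate[of q] into_gasket_def[of q] shrink_in_bary_gasket q
    by (auto simp: z)
qed

lemma norm_into_gasket_diff: "norm (into_gasket p - into_gasket q) = sqrt 2 / 8 * norm (p - q)"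
proof -
  have "into_gasket p - into_gasket q = (1/8) *\<^sub>R (bary p - bary q)" by (simp add: into_gasket_eq algebra_simps)
  then show ?thesis using norm_bary_diff[of p q] by simp
qed

lemma linear_into_gasket: "linear (\<lambda>p. into_gasket p - into_gasket 0)"
  by (rule linearI)
    (simp_all add: vec_eq_iff forall_3 into_gasket_eq bary_nth add_divide_distrib diff_divide_distrib algebra_simps)

lemma similitude_linear_part:
  assumes "similitude_with_factor k f"
  shows "linear (\<lambda>p. f p - f 0)"
proof -
  have *: "linear (\<lambda>p. f p - f 0)" if "\<And>p. f p = k *\<^sub>R (M *v p) + c" for M :: "real^2^2" and c
  proof -
    have "(\<lambda>p. f p - f 0) = (\<lambda>p. k *\<^sub>R (M *v p))" by (simp add: that fun_eq_iff)
    then show ?thesis using linear_compose_scale_right[OF matrix_vector_mul_linear] by metis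
  qed
  show ?thesis using assms * unfolding similitude_with_factor_def by blast
qed

text \<open>The sides of the gasket, written in the form in which a similitude carries them to the edges of a
  row.\<close>
lemma side_point:
  assumes "0 \<le> t" "t \<le> 1"
  shows "t *\<^sub>R vector [1, 0] + 0 *\<^sub>R vector [1/2, sqrt 3 / 2] \<in> sierpinski_gasket"
    and "0 *\<^sub>R vector [1, 0] + t *\<^sub>R vector [1/2, sqrt 3 / 2] \<in> sierpinski_gasket"
    and "(1 - t) *\<^sub>R vector [1, 0] + t *\<^sub>R vector [1/2, sqrt 3 / 2] \<in> sierpinski_gasket"
proof -
  have *: "(1 - t) *\<^sub>R corner_point i + t *\<^sub>R corner_point j \<in> sierpinski_gasket" for i j
  proof -
    have "bary ((1 - t) *\<^sub>R corner_point i + t *\<^sub>R corner_point j) \<in> closed_segment (axis i 1) (axis j 1)"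
      unfolding bary_affine bary_corner_point in_segment using assms by blast
    then show ?thesis using side_subset_bary_gasket bary_gasket_iff by blast
  qed
  show "t *\<^sub>R vector [1, 0] + 0 *\<^sub>R vector [1/2, sqrt 3 / 2] \<in> sierpinski_gasket"
    "0 *\<^sub>R vector [1, 0] + t *\<^sub>R vector [1/2, sqrt 3 / 2] \<in> sierpinski_gasket"
    "(1 - t) *\<^sub>R vector [1, 0] + t *\<^sub>R vector [1/2, sqrt 3 / 2] \<in> sierpinski_gasket"
    using *[of 1 3] *[of 1 2] *[of 3 2] by (simp_all add: corner_point_def)
qed

text \<open>The shrunk copy yields a row whose edge vectors are the images of two unit vectors.  Its
  triangles have size \<open>k/8 < 1/8\<close>, where \<open>k\<close> is the scaling factor, and in barycentric coordinates lengths
  are multiplied by \<open>sqrt 2\<close>.\<close>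
lemma copy_misses_point:
  assumes f: "contractive_similitude f" and sub: "f ` five_sierpinski \<subseteq> five_sierpinski"
    and e: "e \<in> five_sierpinski"
  shows "into_gasket (f e) \<noteq> shrink 1 (spiral_point 3 1 2)"
proof -
  obtain k where k: "k < 1" "0 < k" and sim: "similitude_with_factor k f"
    using f unfolding contractive_similitude_def similitude_with_factor_def by blast
  define L where "L p = into_gasket (f p) - into_gasket (f 0)" for p
  have "L = (\<lambda>p. into_gasket p - into_gasket 0) \<circ> (\<lambda>p. f p - f 0)"
  proof
    fix p
    have "into_gasket (f p - f 0) - into_gasket 0 =
        (into_gasket (f p) - into_gasket 0) - (into_gasket (f 0) - into_gasket 0)"
      using linear_diff[OF linear_into_gasket] by simp
    then show "L p = ((\<lambda>p. into_gasket p - into_gasket 0) \<circ> (\<lambda>p. f p - f 0)) p" by (simp add: L_def)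
  qed
  then have lin: "linear L"
    using linear_compose[OF similitude_linear_part[OF sim] linear_into_gasket] by simp
  have normL: "norm (L p) = sqrt 2 / 8 * k * norm p" for p
    using similitude_dist[OF sim, of p 0] by (simp add: L_def norm_into_gasket_diff dist_norm)
  define x v w where "x = into_gasket (f 0)" and "v = L (vector [1, 0])" and "w = L (vector [1/2, sqrt 3 / 2])"
  have L: "into_gasket (f (s *\<^sub>R vector [1, 0] + t *\<^sub>R vector [1/2, sqrt 3 / 2])) = x + s *\<^sub>R v + t *\<^sub>R w" for s t
  proof -
    have "into_gasket (f p) = x + L p" for p by (simp add: L_def x_def)
    then show ?thesis by (simp add: linear_add[OF lin] linear_scale[OF lin] v_def w_def)
  qed
  have in_gasket: "x + (real m + s) *\<^sub>R v + t *\<^sub>R w \<in> bary_gasket"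
    if "m < 5" "s *\<^sub>R vector [1, 0] + t *\<^sub>R vector [1/2, sqrt 3 / 2] \<in> sierpinski_gasket" for m s t
  proof -
    have "(real m + s) *\<^sub>R vector [1, 0] + t *\<^sub>R vector [1/2, sqrt 3 / 2] \<in> five_sierpinski"
      unfolding five_sierpinski_iff using that
      by (intro exI[of _ m] bexI[OF _ that(2)] conjI) (auto simp: vec_eq_iff forall_2 vector_2)
    then show ?thesis using sub into_gasket_five_sierpinski L[of "real m + s" t] by fastforce
  qed
  have base: "x + (real m + s) *\<^sub>R v \<in> bary_gasket" if "m < 5" "0 \<le> s" "s \<le> 1" for m s
    using in_gasket[OF that(1) side_point(1)[OF that(2,3)]] by simp
  have "gasket.row x v w"
    unfolding gasket.row_def
  proof (intro conjI)
    have n1: "norm (vector [1, 0] :: real^2) = 1" "norm (vector [1/2, sqrt 3 / 2] :: real^2) = 1"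
      "norm (vector [1, 0] - vector [1/2, sqrt 3 / 2] :: real^2) = 1"
      by (simp_all add: norm_vec_def L2_set_def sum_2 vector_2 power_divide)
    show "v \<noteq> 0" using normL[of "vector [1, 0]"] k n1 unfolding v_def by auto
    show "norm w = norm v" unfolding v_def w_def normL n1 ..
    show "norm (v - w) = norm v"
      unfolding v_def w_def linear_diff[OF lin, symmetric] normL n1 ..
    show "row_frame x v w \<subseteq> bary_gasket"
      unfolding row_frame_def
    proof (intro Un_least UN_least subsetI)
      fix p assume "p \<in> closed_segment x (x + 5 *\<^sub>R v)"
      then obtain t where t: "0 \<le> t" "t \<le> 1" "p = (1 - t) *\<^sub>R x + t *\<^sub>R (x + 5 *\<^sub>R v)"
        unfolding in_segment by blast
      \<comment> \<open>The minimum assigns the right end of the base to the last of the five gaskets.\<close>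
      define m where "m = min 4 (nat \<lfloor>5 * t\<rfloor>)"
      have m: "m < 5" "real m \<le> 5 * t" "5 * t - real m \<le> 1"
        unfolding m_def using t by (auto simp: min_def) linarith+
      have "p = x + (real m + (5 * t - real m)) *\<^sub>R v" unfolding t by (simp add: algebra_simps)
      then show "p \<in> bary_gasket" using base[of m "5 * t - real m"] m by simp
    next
      fix m p assume m: "m \<in> {..<5::nat}" and "p \<in> closed_segment (x + real m *\<^sub>R v) (x + real m *\<^sub>R v + w)"
      then obtain t where t: "0 \<le> t" "t \<le> 1" "p = (1 - t) *\<^sub>R (x + real m *\<^sub>R v) + t *\<^sub>R (x + real m *\<^sub>R v + w)"
        unfolding in_segment by blast
      have "p = x + (real m + 0) *\<^sub>R v + t *\<^sub>R w" unfolding t by (simp add: algebra_simps)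
      then show "p \<in> bary_gasket" using in_gasket[of m 0 t] m side_point(2)[OF t(1,2)] by simp
    next
      fix m p assume m: "m \<in> {..<5::nat}" and "p \<in> closed_segment (x + real (Suc m) *\<^sub>R v) (x + real m *\<^sub>R v + w)"
      then obtain t where t: "0 \<le> t" "t \<le> 1" "p = (1 - t) *\<^sub>R (x + real (Suc m) *\<^sub>R v) + t *\<^sub>R (x + real m *\<^sub>R v + w)"
        unfolding in_segment by blast
      have "p = x + (real m + (1 - t)) *\<^sub>R v + t *\<^sub>R w" unfolding t by (simp add: algebra_simps)
      then show "p \<in> bary_gasket" using in_gasket[of m "1 - t" t] m side_point(3)[OF t(1,2)] by simp
    qed
  qed
  moreover have "(norm v)\<^sup>2 < 2 * (1/8)\<^sup>2"
  proof -
    have "norm v = sqrt 2 / 8 * k"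
      unfolding v_def normL by (simp add: norm_vec_def L2_set_def sum_2 vector_2)
    then have "(norm v)\<^sup>2 = (sqrt 2 / 8 * k)\<^sup>2" by (rule arg_cong)
    also have "\<dots> = 2 * (1/8)\<^sup>2 * k\<^sup>2" by (simp add: power_mult_distrib power_divide)
    finally have "(norm v)\<^sup>2 = 2 * (1/8)\<^sup>2 * k\<^sup>2" .
    moreover have "k\<^sup>2 < 1" using k by (simp add: power_less_one_iff)
    ultimately show ?thesis by simp
  qed
  ultimately have "shrink 1 (spiral_point 3 1 2) \<notin> row_hull x v w"
    by (rule gasket.small_row_misses_point) simp
  moreover have "into_gasket (f e) \<in> row_hull x v w"
  proof -
    obtain j q where jq: "j \<le> 4" "q \<in> sierpinski_gasket" "e = q + vector [real j, 0]"
      using e five_sierpinski_iff by blast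
    have q: "bary q \<in> bary_gasket" using jq bary_gasket_iff by simp
    have "e = (real j + bary q$3) *\<^sub>R vector [1, 0] + bary q$2 *\<^sub>R vector [1/2, sqrt 3 / 2]"
      unfolding jq by (simp add: vec_eq_iff forall_2 bary_nth vector_2)
    then have "into_gasket (f e) = x + (real j + bary q$3) *\<^sub>R v + bary q$2 *\<^sub>R w" using L by simp
    moreover have "0 \<le> bary q$3" "0 \<le> bary q$2" "bary q$3 + bary q$2 \<le> 1"
      using gasket.nonneg[OF q, of 1] gasket.nonneg[OF q, of 2] gasket.nonneg[OF q, of 3]
        bary_sum[of q] by linarith+
    ultimately show ?thesis unfolding row_hull_def using jq(1) by fastforce
  qed
  ultimately show ?thesis by auto
qed

theorem theorem3p1:
  shows "\<not> (\<exists>fs :: (real^2 \<Rightarrow> real^2) list.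
           fs \<noteq> [] \<and> (\<forall>f\<in>set fs. contractive_similitude f) \<and> five_sierpinski = attractor fs)"
proof
  assume "\<exists>fs :: (real^2 \<Rightarrow> real^2) list.
           fs \<noteq> [] \<and> (\<forall>f\<in>set fs. contractive_similitude f) \<and> five_sierpinski = attractor fs"
  then obtain fs where fs: "fs \<noteq> []" "\<forall>f\<in>set fs. contractive_similitude f"
    "five_sierpinski = attractor fs" by blast
  have inv: "five_sierpinski = (\<Union>f\<in>set fs. f ` five_sierpinski)"
    using attractor_eq_iff[OF fs(1,2), of five_sierpinski] fs(3) by blast
  \<comment> \<open>The uncovered point lies in the middle one of the five gaskets.\<close>
  obtain q where q: "q \<in> sierpinski_gasket" "bary q = spiral_point 2 3 1"
    using spiral_point_in_bary_gasket[of 2 3 1] unfolding bary_gasket_def by auto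
  define p where "p = q + vector [2, 0]"
  have "p \<in> five_sierpinski"
    unfolding five_sierpinski_iff p_def using q(1) by (intro exI[of _ 2]) auto
  then obtain f e where f: "f \<in> set fs" "e \<in> five_sierpinski" "p = f e" using inv by blast
  have "f ` five_sierpinski \<subseteq> five_sierpinski" using inv f(1) by blast
  then have "into_gasket (f e) \<noteq> shrink 1 (spiral_point 3 1 2)"
    using copy_misses_point[of f e] fs(2) f by blast
  moreover have "into_gasket p = shrink 1 (spiral_point 3 1 2)"
    unfolding p_def into_gasket_translate(2) q(2) shrink_spiral_point ..
  ultimately show False using f(3) by simp
qed

end
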